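(* Let $G=A\rtimes K$ with $A$ and $K$ finite abelian groups, let $\pi:G\to K$ be the natural projection, and for $B\le K$ put $C_B:=\mathrm{C}_A(B)$, \[ \Lambda(B):=\{H\le G:\ H\text{ abelian},\ \pi(H)=B,\ H\cap A=C_B\}, \qquad \lambda(B):=|\Lambda(B)|. \] If $B\le K$ satisfies $\gcd(|A|,|B|)=1$, then \[ \lambda(B)=|A:C_B|. \] Equivalently, the elements of $\Lambda(B)$ are exactly the preimages (under $A\rtimes B\to (A/C_B)\rtimes B$) of the complements of $A/C_B$ in $(A/C_B)\rtimes B$, and there are $|A:C_B|$ of them.
   Context: $A$ is the normal factor of $A\rtimes K$, and $\mathrm{C}_A(B)$ is the subgroup of elements of $A$ fixed by every element of $B$ under the action of $K$ on $A$. A complement of a normal subgroup $N$ in a group $X$ is a subgroup $L\le X$ with $NL=X$ and $N\cap L=1$. *)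

theory Defs
  imports "HOL-Algebra.Algebra"
begin

text \<open>The normal factor \<open>A\<close> is embedded as \<open>carrier A \<times> {\<one>\<^bsub>K\<^esub>}\<close>, the natural projection onto
  \<open>K\<close> is \<^const>\<open>snd\<close>.\<close>

definition semidirect ::
  "('a, 'm) monoid_scheme \<Rightarrow> ('k, 'n) monoid_scheme \<Rightarrow> ('k \<Rightarrow> 'a \<Rightarrow> 'a) \<Rightarrow> ('a \<times> 'k) monoid"
  where "semidirect A K \<phi> =
    \<lparr>carrier = carrier A \<times> carrier K,
     monoid.mult = (\<lambda>(a, k) (b, l). (a \<otimes>\<^bsub>A\<^esub> \<phi> k b, k \<otimes>\<^bsub>K\<^esub> l)),
     one = (\<one>\<^bsub>A\<^esub>, \<one>\<^bsub>K\<^esub>)\<rparr>"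

definition fixed_subgroup ::
  "('a, 'm) monoid_scheme \<Rightarrow> ('k \<Rightarrow> 'a \<Rightarrow> 'a) \<Rightarrow> 'k set \<Rightarrow> 'a set"
  where "fixed_subgroup A \<phi> B = {a \<in> carrier A. \<forall>b\<in>B. \<phi> b a = a}"

definition Lambda_set ::
  "('a, 'm) monoid_scheme \<Rightarrow> ('k, 'n) monoid_scheme \<Rightarrow> ('k \<Rightarrow> 'a \<Rightarrow> 'a) \<Rightarrow> 'k set
    \<Rightarrow> ('a \<times> 'k) set set"
  where "Lambda_set A K \<phi> B =
    {H. subgroup H (semidirect A K \<phi>) \<and>
        comm_group ((semidirect A K \<phi>)\<lparr>carrier := H\<rparr>) \<and>
        snd ` H = B \<and>
        H \<inter> (carrier A \<times> {\<one>\<^bsub>K\<^esub>}) = fixed_subgroup A \<phi> B \<times> {\<one>\<^bsub>K\<^esub>}}"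

definition complements :: "('g, 'm) monoid_scheme \<Rightarrow> 'g set \<Rightarrow> 'g set set"
  where "complements G N =
    {L. normal N G \<and> subgroup L G \<and> N <#>\<^bsub>G\<^esub> L = carrier G \<and> N \<inter> L = {\<one>\<^bsub>G\<^esub>}}"

text \<open>The induced action on \<open>A Mod C\<close> sends the coset \<open>C #> a\<close> to \<open>C #> \<phi> k a\<close>; for \<open>C\<close>
  stable under \<open>\<phi> k\<close> this is the image of the coset under \<open>\<phi> k\<close>.\<close>

definition quotient_action ::
  "('a, 'm) monoid_scheme \<Rightarrow> 'a set \<Rightarrow> ('k \<Rightarrow> 'a \<Rightarrow> 'a) \<Rightarrow> 'k \<Rightarrow> 'a set \<Rightarrow> 'a set"
  where "quotient_action A C \<phi> k = (\<lambda>S \<in> carrier (A Mod C). \<phi> k ` S)"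

definition quotient_map :: "('a, 'm) monoid_scheme \<Rightarrow> 'a set \<Rightarrow> 'a \<times> 'k \<Rightarrow> 'a set \<times> 'k"
  where "quotient_map A C = (\<lambda>(a, k). (C #>\<^bsub>A\<^esub> a, k))"


lemma actD:
  assumes "\<phi> \<in> hom K (AutoGroup A)" "k \<in> carrier K"
  shows "\<phi> k \<in> hom A A" "bij_betw (\<phi> k) (carrier A) (carrier A)"
    "\<phi> k \<in> extensional (carrier A)"
  using assms by (auto simp: hom_def AutoGroup_def auto_def Bij_def)

lemma act_closed:
  assumes "\<phi> \<in> hom K (AutoGroup A)" "k \<in> carrier K" "a \<in> carrier A"
  shows "\<phi> k a \<in> carrier A"
  using actD(1)[OF assms(1,2)] assms(3) by (auto simp: hom_def)

lemma act_mult: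
  assumes "\<phi> \<in> hom K (AutoGroup A)" "k \<in> carrier K" "a \<in> carrier A" "b \<in> carrier A"
  shows "\<phi> k (a \<otimes>\<^bsub>A\<^esub> b) = \<phi> k a \<otimes>\<^bsub>A\<^esub> \<phi> k b"
  using actD(1)[OF assms(1,2)] assms(3,4) by (auto simp: hom_def)

lemma act_comp:
  assumes "\<phi> \<in> hom K (AutoGroup A)" "k \<in> carrier K" "l \<in> carrier K" "a \<in> carrier A"
  shows "\<phi> (k \<otimes>\<^bsub>K\<^esub> l) a = \<phi> k (\<phi> l a)"
proof -
  have "\<phi> k \<in> Bij (carrier A)" "\<phi> l \<in> Bij (carrier A)"
    using assms by (auto simp: hom_def AutoGroup_def auto_def)
  moreover have "\<phi> (k \<otimes>\<^bsub>K\<^esub> l) = \<phi> k \<otimes>\<^bsub>AutoGroup A\<^esub> \<phi> l"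
    using assms by (simp add: hom_mult)
  ultimately show ?thesis
    using assms(4) by (simp add: AutoGroup_def BijGroup_def compose_def)
qed

lemma act_one:
  assumes "group K" "\<phi> \<in> hom K (AutoGroup A)" "a \<in> carrier A"
  shows "\<phi> \<one>\<^bsub>K\<^esub> a = a"
proof -
  interpret K: group K by fact
  have "\<phi> \<one>\<^bsub>K\<^esub> (\<phi> \<one>\<^bsub>K\<^esub> a) = \<phi> \<one>\<^bsub>K\<^esub> a"
    using act_comp[OF assms(2) K.one_closed K.one_closed assms(3)] by simp
  then show ?thesis
    using actD(2)[OF assms(2) K.one_closed] act_closed[OF assms(2) K.one_closed assms(3)] assms(3)
    by (auto simp: bij_betw_def inj_on_def)
qed

lemma group_semidirect:
  assumes "group A" "group K" "\<phi> \<in> hom K (AutoGroup A)"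
  shows "group (semidirect A K \<phi>)"
proof -
  interpret A: group A by fact
  interpret K: group K by fact
  note c = act_closed[OF assms(3)] and m = act_mult[OF assms(3)] and cc = act_comp[OF assms(3)]
    and o = act_one[OF assms(2,3)]
  have inv: "\<exists>b\<in>carrier A. \<exists>l\<in>carrier K. b \<otimes>\<^bsub>A\<^esub> \<phi> l a = \<one>\<^bsub>A\<^esub> \<and> l \<otimes>\<^bsub>K\<^esub> k = \<one>\<^bsub>K\<^esub>"
    if "a \<in> carrier A" "k \<in> carrier K" for a k
    by (rule bexI[of _ "inv\<^bsub>A\<^esub> (\<phi> (inv\<^bsub>K\<^esub> k) a)"], rule bexI[of _ "inv\<^bsub>K\<^esub> k"])
      (use that c in auto)
  show ?thesis
    by (rule groupI) (use inv in \<open>auto simp: semidirect_def c m cc o A.m_assoc K.m_assoc\<close>)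
qed

lemma quotient_action_rcos:
  assumes "group A" "\<phi> \<in> hom K (AutoGroup A)" "subgroup B K" "b \<in> B" "a \<in> carrier A"
  defines "C \<equiv> fixed_subgroup A \<phi> B"
  shows "quotient_action A C \<phi> b (C #>\<^bsub>A\<^esub> a) = C #>\<^bsub>A\<^esub> \<phi> b a"
proof -
  have b: "b \<in> carrier K" using assms(3,4) by (rule subgroup.mem_carrier)
  have "\<phi> b (c \<otimes>\<^bsub>A\<^esub> a) = c \<otimes>\<^bsub>A\<^esub> \<phi> b a" if "c \<in> C" for c
    using that act_mult[OF assms(2) b _ assms(5), of c] assms(4)
    by (auto simp: C_def fixed_subgroup_def)
  then have "\<phi> b ` (C #>\<^bsub>A\<^esub> a) = C #>\<^bsub>A\<^esub> \<phi> b a"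
    by (auto simp: r_coset_def image_iff)
  moreover have "C #>\<^bsub>A\<^esub> a \<in> carrier (A Mod C)"
    using assms(5) by (simp add: carrier_FactGroup)
  ultimately show ?thesis by (simp add: quotient_action_def)
qed

end

theory Submission
  imports Defs
begin

text \<open>A complement of \<open>A/C\<close> in \<open>(A/C) \<rtimes> B\<close> is the graph of a crossed homomorphism
  \<open>f : B \<rightarrow> A/C\<close>. Coprimality lets one average \<open>f\<close> over \<open>B\<close>, so \<open>f b = t \<cdot> (b \<cdot> t)\<^sup>-\<^sup>1\<close> for some
  \<open>t\<close>; and \<open>B\<close> has no nontrivial fixed point on \<open>A/C\<close>, so \<open>t\<close> is determined by \<open>f\<close>. Hence there
  are \<open>|A : C|\<close> complements. The preimage of such a complement is a conjugate of the abelian group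
  \<open>C \<times> B\<close> under an element of \<open>A\<close>, hence lies in \<open>\<Lambda>(B)\<close>; conversely \<open>H \<in> \<Lambda>(B)\<close> contains \<open>C\<close>, so it
  is the preimage of its image, which is a complement.\<close>

section \<open>Roots in finite abelian groups and principal crossed homomorphisms\<close>

lemma (in group) inv_mult_cancel_left:
  "x \<in> carrier G \<Longrightarrow> y \<in> carrier G \<Longrightarrow> inv x \<otimes> (x \<otimes> y) = y"
  by (simp flip: m_assoc)

lemma (in group) mult_inv_cancel_left:
  "x \<in> carrier G \<Longrightarrow> y \<in> carrier G \<Longrightarrow> x \<otimes> (inv x \<otimes> y) = y"
  by (simp flip: m_assoc)

text \<open>By Bezout, \<open>n * m\<close> is one more than a multiple of the group order, and the
  order annihilates every element. This provides the division by \<open>|B|\<close> needed for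
  averaging, and it also shows that an element whose \<open>|B|\<close>-th power is trivial is
  itself trivial.\<close>

lemma (in comm_group) pow_coprime_card_invertible:
  assumes "finite (carrier G)" "coprime (card (carrier G)) n"
  shows "\<exists>m::nat. \<forall>x\<in>carrier G. (x [^] n) [^] m = x"
proof (cases "n = 0")
  case True
  \<comment> \<open>Being coprime to \<open>0\<close> means being \<open>1\<close>. This case is
    separate because the Bezout identity \<open>n * m = |G| * k + 1\<close> is obtained from a
    nonzero \<open>n\<close>.\<close>
  then have "carrier G = {\<one>}"
    using assms one_closed by (metis card_1_singletonE coprime_0_right_iff nat_dvd_1_iff_1 singletonD)
  then show ?thesis by auto
next
  case False
  obtain m k where mk: "n * m = card (carrier G) * k + 1"
    using bezout_nat[OF False, of "card (carrier G)"] assms(2)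
    by (auto simp: coprime_iff_gcd_eq_1 gcd.commute)
  have "(x [^] n) [^] m = x" if "x \<in> carrier G" for x
  proof -
    have "(x [^] n) [^] m = (x [^] order G) [^] k \<otimes> x"
      using that by (simp add: nat_pow_pow mk order_def flip: nat_pow_mult)
    then show ?thesis using that pow_order_eq_1[OF that] by simp
  qed
  then show ?thesis by blast
qed

lemma (in comm_group) hom_finprod:
  assumes "h \<in> hom G G" "finite I" "f \<in> I \<rightarrow> carrier G"
  shows "h (finprod G f I) = (\<Otimes>i\<in>I. h (f i))"
  using assms(2,3)
proof (induction I rule: finite_induct)
  case empty
  then show ?case using hom_one[OF assms(1)] is_group by simp
next
  case (insert i I)
  then have "(\<lambda>i. h (f i)) \<in> insert i I \<rightarrow> carrier G"
    using assms(1) by (auto simp: hom_def)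
  with insert show ?case using assms(1) by (auto simp: hom_mult Pi_iff)
qed

text \<open>Multiply the crossed identity over all \<open>r\<close>. Left translation by
  \<open>q\<close> permutes \<open>Q\<close>, so the product \<open>s\<close> of all values of
  \<open>f\<close> satisfies \<open>s = (f q)^n * \<psi> q s\<close> with \<open>n = |Q|\<close>.
  Extracting the unique \<open>n\<close>-th root gives \<open>t = f q * \<psi> q t\<close>. In
  cohomological terms, the first cohomology group vanishes in the coprime case.\<close>

lemma (in comm_group) crossed_hom_principal:
  assumes "finite (carrier G)" "group Q" "finite (carrier Q)"
    and cop: "coprime (card (carrier G)) (card (carrier Q))"
    and hom: "\<And>q. q \<in> carrier Q \<Longrightarrow> \<psi> q \<in> hom G G"
    and f: "\<And>q. q \<in> carrier Q \<Longrightarrow> f q \<in> carrier G"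
    and crossed: "\<And>q r. q \<in> carrier Q \<Longrightarrow> r \<in> carrier Q \<Longrightarrow>
      f (q \<otimes>\<^bsub>Q\<^esub> r) = f q \<otimes> \<psi> q (f r)"
  obtains t where "t \<in> carrier G" "\<And>q. q \<in> carrier Q \<Longrightarrow> f q = t \<otimes> inv (\<psi> q t)"
proof -
  interpret Q: group Q by fact
  define n where "n = card (carrier Q)"
  obtain m :: nat where m: "\<forall>x\<in>carrier G. (x [^] n) [^] m = x"
    using pow_coprime_card_invertible[OF assms(1) cop[folded n_def]] by blast
  define s where "s = (\<Otimes>r\<in>carrier Q. f r)"
  \<comment> \<open>Since taking \<open>m\<close>-th powers inverts taking \<open>n\<close>-th
    powers, \<open>t\<close> is the \<open>n\<close>-th root of \<open>s\<close>, that is, the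
    multiplicative average of the values of \<open>f\<close>.\<close>
  define t where "t = s [^] m"
  have s: "s \<in> carrier G" unfolding s_def by (rule finprod_closed) (use f in auto)
  have t: "t \<in> carrier G" unfolding t_def using s by simp
  have tn: "t [^] n = s"
    using m s by (simp add: t_def nat_pow_pow mult.commute)
  have "f q = t \<otimes> inv (\<psi> q t)" if q: "q \<in> carrier Q" for q
  proof -
    interpret h: group_hom G G "\<psi> q"
      using hom[OF q] by (simp add: group_hom_def group_hom_axioms_def is_group)
    have bij: "bij_betw (\<lambda>r. q \<otimes>\<^bsub>Q\<^esub> r) (carrier Q) (carrier Q)"
      using Q.inj_on_cmult[OF q] Q.surj_const_mult[OF q] by (simp add: bij_betw_def)
    have "s = (\<Otimes>r\<in>carrier Q. f (q \<otimes>\<^bsub>Q\<^esub> r))"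
      unfolding s_def
      using finprod_reindex[of f "\<lambda>r. q \<otimes>\<^bsub>Q\<^esub> r" "carrier Q"] bij f
      by (auto simp: bij_betw_def)
    also have "\<dots> = (\<Otimes>r\<in>carrier Q. f q \<otimes> \<psi> q (f r))"
      by (rule finprod_cong') (use q f crossed in auto)
    also have "\<dots> = (\<Otimes>r\<in>carrier Q. f q) \<otimes> (\<Otimes>r\<in>carrier Q. \<psi> q (f r))"
      by (rule finprod_multf) (use q f in auto)
    also have "(\<Otimes>r\<in>carrier Q. f q) = f q [^] n"
      unfolding n_def using f q by (simp add: finprod_const)
    also have "(\<Otimes>r\<in>carrier Q. \<psi> q (f r)) = \<psi> q s"
      unfolding s_def
      by (rule hom_finprod[OF hom[OF q] assms(3), symmetric]) (use f in auto)
    also have "\<psi> q s = \<psi> q t [^] n"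
      using t tn h.hom_nat_pow by metis
    finally have "t [^] n = (f q \<otimes> \<psi> q t) [^] n"
      using f q t tn by (simp add: pow_mult_distrib m_comm)
    \<comment> \<open>Raising both sides to the power \<open>m\<close> cancels the exponent
      \<open>n\<close>.\<close>
    then have "t = f q \<otimes> \<psi> q t"
      using m t f q by (metis h.hom_closed m_closed)
    then show ?thesis
      using f q t by (metis h.hom_closed inv_solve_right)
  qed
  with t show ?thesis by (rule that)
qed

section \<open>Complements of the normal factor in a semidirect product\<close>

lemma semidirect_simps:
  "carrier (semidirect A K \<phi>) = carrier A \<times> carrier K"
  "(a, k) \<otimes>\<^bsub>semidirect A K \<phi>\<^esub> (b, l) = (a \<otimes>\<^bsub>A\<^esub> \<phi> k b, k \<otimes>\<^bsub>K\<^esub> l)"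
  "\<one>\<^bsub>semidirect A K \<phi>\<^esub> = (\<one>\<^bsub>A\<^esub>, \<one>\<^bsub>K\<^esub>)"
  by (auto simp: semidirect_def)

lemma act_group_hom:
  assumes "group A" "\<phi> \<in> hom K (AutoGroup A)" "k \<in> carrier K"
  shows "group_hom A A (\<phi> k)"
  using assms actD(1) by (auto simp: group_hom_def group_hom_axioms_def)

lemma semidirect_inv:
  assumes "group A" "group K" "\<phi> \<in> hom K (AutoGroup A)" "a \<in> carrier A" "k \<in> carrier K"
  shows "inv\<^bsub>semidirect A K \<phi>\<^esub> (a, k) = (\<phi> (inv\<^bsub>K\<^esub> k) (inv\<^bsub>A\<^esub> a), inv\<^bsub>K\<^esub> k)"
proof -
  interpret A: group A by fact
  interpret K: group K by fact
  interpret S: group "semidirect A K \<phi>" using assms by (intro group_semidirect)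
  have "\<phi> (inv\<^bsub>K\<^esub> k) (inv\<^bsub>A\<^esub> a) \<otimes>\<^bsub>A\<^esub> \<phi> (inv\<^bsub>K\<^esub> k) a = \<one>\<^bsub>A\<^esub>"
    using act_mult[OF assms(3), of "inv\<^bsub>K\<^esub> k" "inv\<^bsub>A\<^esub> a" a] assms(4,5)
      group_hom.hom_one[OF act_group_hom[OF assms(1,3)], of "inv\<^bsub>K\<^esub> k"] by simp
  then show ?thesis
    using assms(4,5) act_closed[OF assms(3)]
    by (intro S.inv_equality) (auto simp: semidirect_simps)
qed

text \<open>The normal factor is the kernel of the projection \<open>snd\<close>.\<close>

lemma semidirect_normal_factor:
  assumes "group A" "group K" "\<phi> \<in> hom K (AutoGroup A)"
  shows "carrier A \<times> {\<one>\<^bsub>K\<^esub>} \<lhd> semidirect A K \<phi>"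
proof -
  interpret A: group A by fact
  interpret K: group K by fact
  interpret S: group "semidirect A K \<phi>" using assms by (intro group_semidirect)
  interpret h: group_hom "semidirect A K \<phi>" K snd
    by unfold_locales (auto simp: hom_def semidirect_simps)
  have "kernel (semidirect A K \<phi>) K snd = carrier A \<times> {\<one>\<^bsub>K\<^esub>}"
    by (auto simp: kernel_def semidirect_simps)
  then show ?thesis using h.normal_kernel by simp
qed

text \<open>Surjectivity onto \<open>K\<close> already yields the product condition: any
  \<open>(x, k)\<close> shares its second component with some element of \<open>L\<close>, and two
  such elements differ by a left factor from the normal factor.\<close>

lemma complementI_semidirect:
  assumes "group A" "group K" "\<phi> \<in> hom K (AutoGroup A)"
    and L: "subgroup L (semidirect A K \<phi>)" and snd: "snd ` L = carrier K"
    and int: "(carrier A \<times> {\<one>\<^bsub>K\<^esub>}) \<inter> L = {\<one>\<^bsub>semidirect A K \<phi>\<^esub>}"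
  shows "L \<in> complements (semidirect A K \<phi>) (carrier A \<times> {\<one>\<^bsub>K\<^esub>})"
proof -
  interpret A: group A by fact
  interpret K: group K by fact
  have sub: "L \<subseteq> carrier A \<times> carrier K"
    using subgroup.subset[OF L] by (simp add: semidirect_simps)
  have "(carrier A \<times> {\<one>\<^bsub>K\<^esub>}) <#>\<^bsub>semidirect A K \<phi>\<^esub> L = carrier (semidirect A K \<phi>)"
  proof
    show "(carrier A \<times> {\<one>\<^bsub>K\<^esub>}) <#>\<^bsub>semidirect A K \<phi>\<^esub> L \<subseteq> carrier (semidirect A K \<phi>)"
      using sub act_closed[OF assms(3)] by (auto simp: set_mult_def semidirect_simps)
    show "carrier (semidirect A K \<phi>) \<subseteq> (carrier A \<times> {\<one>\<^bsub>K\<^esub>}) <#>\<^bsub>semidirect A K \<phi>\<^esub> L"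
    proof clarify
      fix x k assume "(x, k) \<in> carrier (semidirect A K \<phi>)"
      then have xk: "x \<in> carrier A" "k \<in> carrier K" by (auto simp: semidirect_simps)
      then obtain p where pL: "(p, k) \<in> L" using snd by force
      then have p: "p \<in> carrier A" using sub by auto
      have "(x, k) = (x \<otimes>\<^bsub>A\<^esub> inv\<^bsub>A\<^esub> p, \<one>\<^bsub>K\<^esub>) \<otimes>\<^bsub>semidirect A K \<phi>\<^esub> (p, k)"
        using xk p act_one[OF assms(2,3)] by (simp add: semidirect_simps A.m_assoc)
      then show "(x, k) \<in> (carrier A \<times> {\<one>\<^bsub>K\<^esub>}) <#>\<^bsub>semidirect A K \<phi>\<^esub> L"
        using p pL xk unfolding set_mult_def by fastforce
    qed
  qed
  then show ?thesis
    using L int semidirect_normal_factor[OF assms(1-3)] by (simp add: complements_def)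
qed

text \<open>Besides being the graph of a principal crossed homomorphism, this is the conjugate of
  the standard complement \<open>{1} \<times> K\<close> by the element
  \<open>(a, 1)\<close>.\<close>

definition principal_graph ::
  "('a, 'm) monoid_scheme \<Rightarrow> ('k, 'n) monoid_scheme \<Rightarrow> ('k \<Rightarrow> 'a \<Rightarrow> 'a) \<Rightarrow> 'a \<Rightarrow> ('a \<times> 'k) set"
  where "principal_graph A K \<phi> a = (\<lambda>k. (a \<otimes>\<^bsub>A\<^esub> inv\<^bsub>A\<^esub> \<phi> k a, k)) ` carrier K"

text \<open>The crossed identity \<open>mult\<close> makes the graph closed under products, and the
  crossed homomorphism takes the value \<open>1\<close> at the identity of \<open>K\<close>, so the
  graph meets the normal factor trivially.\<close>

lemma principal_graph_complement:
  assumes "comm_group A" "group K" "\<phi> \<in> hom K (AutoGroup A)" "a \<in> carrier A"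
  shows "principal_graph A K \<phi> a \<in> complements (semidirect A K \<phi>) (carrier A \<times> {\<one>\<^bsub>K\<^esub>})"
proof -
  interpret A: comm_group A by fact
  interpret K: group K by fact
  interpret S: group "semidirect A K \<phi>" using assms A.is_group by (intro group_semidirect)
  note c = act_closed[OF assms(3)] and m = act_mult[OF assms(3)] and cc = act_comp[OF assms(3)]
    and o = act_one[OF assms(2,3)]
  have i: "\<phi> k (inv\<^bsub>A\<^esub> x) = inv\<^bsub>A\<^esub> \<phi> k x" if "k \<in> carrier K" "x \<in> carrier A" for k x
    using group_hom.hom_inv[OF act_group_hom[OF A.is_group assms(3)]] that by blast
  let ?P = "principal_graph A K \<phi> a"
  have sub: "?P \<subseteq> carrier A \<times> carrier K"
    using assms(4) c by (auto simp: principal_graph_def)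
  have mult: "(a \<otimes>\<^bsub>A\<^esub> inv\<^bsub>A\<^esub> \<phi> k a) \<otimes>\<^bsub>A\<^esub> \<phi> k (a \<otimes>\<^bsub>A\<^esub> inv\<^bsub>A\<^esub> \<phi> l a) = a \<otimes>\<^bsub>A\<^esub> inv\<^bsub>A\<^esub> \<phi> (k \<otimes>\<^bsub>K\<^esub> l) a"
    if "k \<in> carrier K" "l \<in> carrier K" for k l
  proof -
    have "(a \<otimes>\<^bsub>A\<^esub> inv\<^bsub>A\<^esub> \<phi> k a) \<otimes>\<^bsub>A\<^esub> \<phi> k (a \<otimes>\<^bsub>A\<^esub> inv\<^bsub>A\<^esub> \<phi> l a) =
      a \<otimes>\<^bsub>A\<^esub> (inv\<^bsub>A\<^esub> \<phi> k a \<otimes>\<^bsub>A\<^esub> \<phi> k a) \<otimes>\<^bsub>A\<^esub> inv\<^bsub>A\<^esub> \<phi> k (\<phi> l a)"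
      using that assms(4) c m i by (simp add: A.m_assoc A.inv_mult_cancel_left)
    then show ?thesis using that assms(4) c cc by simp
  qed
  have "subgroup ?P (semidirect A K \<phi>)"
  proof (rule S.subgroupI)
    show "?P \<subseteq> carrier (semidirect A K \<phi>)" using sub by (simp add: semidirect_simps)
    show "?P \<noteq> {}" by (auto simp: principal_graph_def)
  next
    fix x assume "x \<in> ?P"
    then obtain k where k: "k \<in> carrier K" "x = (a \<otimes>\<^bsub>A\<^esub> inv\<^bsub>A\<^esub> \<phi> k a, k)"
      by (auto simp: principal_graph_def)
    have "\<phi> (inv\<^bsub>K\<^esub> k) (\<phi> k a) = a"
      using cc[of "inv\<^bsub>K\<^esub> k" k a] k assms(4) o by simp
    then have "\<phi> (inv\<^bsub>K\<^esub> k) (inv\<^bsub>A\<^esub> (a \<otimes>\<^bsub>A\<^esub> inv\<^bsub>A\<^esub> \<phi> k a)) = a \<otimes>\<^bsub>A\<^esub> inv\<^bsub>A\<^esub> \<phi> (inv\<^bsub>K\<^esub> k) a"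
      using k assms(4) c m i by (simp add: A.inv_mult A.m_comm)
    then show "inv\<^bsub>semidirect A K \<phi>\<^esub> x \<in> ?P"
      using k assms(4) c by (auto simp: semidirect_inv[OF A.is_group assms(2,3)] principal_graph_def)
  next
    fix x y assume "x \<in> ?P" "y \<in> ?P"
    then show "x \<otimes>\<^bsub>semidirect A K \<phi>\<^esub> y \<in> ?P"
      by (auto simp: principal_graph_def semidirect_simps mult)
  qed
  moreover have "snd ` ?P = carrier K"
    by (force simp: principal_graph_def)
  moreover have "(carrier A \<times> {\<one>\<^bsub>K\<^esub>}) \<inter> ?P = {\<one>\<^bsub>semidirect A K \<phi>\<^esub>}"
    using assms(4) o by (force simp: principal_graph_def semidirect_simps)
  ultimately show ?thesis
    by (rule complementI_semidirect[OF A.is_group assms(2,3)])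
qed

text \<open>Over each \<open>k\<close> a complement \<open>L\<close> has exactly one element: one
  exists since \<open>L\<close> and the normal factor generate everything as a product, and it is
  unique since they meet trivially. So \<open>L\<close> is the graph of a function \<open>f\<close>,
  closure of \<open>L\<close> says that \<open>f\<close> is a crossed homomorphism, and coprimality
  makes \<open>f\<close> principal.\<close>

lemma complements_semidirect_coprime:
  assumes "comm_group A" "finite (carrier A)" "group K" "finite (carrier K)"
    and \<phi>: "\<phi> \<in> hom K (AutoGroup A)"
    and cop: "coprime (card (carrier A)) (card (carrier K))"
  shows "complements (semidirect A K \<phi>) (carrier A \<times> {\<one>\<^bsub>K\<^esub>}) = principal_graph A K \<phi> ` carrier A"
proof (intro equalityI subsetI)
  interpret A: comm_group A by fact
  interpret K: group K by fact
  interpret S: group "semidirect A K \<phi>" using assms A.is_group by (intro group_semidirect)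
  note c = act_closed[OF \<phi>] and o = act_one[OF assms(3) \<phi>]
  let ?S = "semidirect A K \<phi>" and ?N = "carrier A \<times> {\<one>\<^bsub>K\<^esub>}"
  fix L assume "L \<in> complements ?S ?N"
  then have L: "subgroup L ?S" and prod: "?N <#>\<^bsub>?S\<^esub> L = carrier ?S" and int: "?N \<inter> L = {\<one>\<^bsub>?S\<^esub>}"
    by (auto simp: complements_def)
  have Lsub: "L \<subseteq> carrier A \<times> carrier K"
    using subgroup.subset[OF L] by (simp add: semidirect_simps)
  have ex: "\<exists>x. (x, k) \<in> L" if "k \<in> carrier K" for k
  proof -
    have "(\<one>\<^bsub>A\<^esub>, k) \<in> ?N <#>\<^bsub>?S\<^esub> L" using that prod by (simp add: semidirect_simps)
    then obtain u x l where "(x, l) \<in> L" "(\<one>\<^bsub>A\<^esub>, k) = (u, \<one>\<^bsub>K\<^esub>) \<otimes>\<^bsub>?S\<^esub> (x, l)"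
      unfolding set_mult_def by auto
    moreover from this have "k = l" using Lsub by (auto simp: semidirect_simps)
    ultimately show ?thesis by blast
  qed
  have uniq: "x = y" if "(x, k) \<in> L" "(y, k) \<in> L" for x y k
  proof -
    have xy: "x \<in> carrier A" "y \<in> carrier A" "k \<in> carrier K" using that Lsub by auto
    \<comment> \<open>This quotient has trivial second component, and the action of \<open>k\<close>
      undoes that of its inverse, so it equals \<open>(x * inv y, 1)\<close>.\<close>
    have "(x, k) \<otimes>\<^bsub>?S\<^esub> inv\<^bsub>?S\<^esub> (y, k) \<in> L"
      using that L by (simp add: subgroup.m_closed subgroup.m_inv_closed)
    moreover have "\<phi> k (\<phi> (inv\<^bsub>K\<^esub> k) (inv\<^bsub>A\<^esub> y)) = inv\<^bsub>A\<^esub> y"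
      using act_comp[OF \<phi>, of k "inv\<^bsub>K\<^esub> k" "inv\<^bsub>A\<^esub> y"] xy o by simp
    ultimately have "(x \<otimes>\<^bsub>A\<^esub> inv\<^bsub>A\<^esub> y, \<one>\<^bsub>K\<^esub>) \<in> ?N \<inter> L"
      using xy by (simp add: semidirect_inv[OF A.is_group assms(3) \<phi>] semidirect_simps)
    then have "x \<otimes>\<^bsub>A\<^esub> inv\<^bsub>A\<^esub> y = \<one>\<^bsub>A\<^esub>" unfolding int by (simp add: semidirect_simps)
    then show ?thesis using xy by (metis A.inv_closed A.inv_equality A.inv_inv)
  qed
  obtain f where f: "\<And>k. k \<in> carrier K \<Longrightarrow> (f k, k) \<in> L" using ex by metis
  \<comment> \<open>Both sides are first components of elements of \<open>L\<close> lying over the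
    product of \<open>k\<close> and \<open>l\<close>.\<close>
  have crossed: "f (k \<otimes>\<^bsub>K\<^esub> l) = f k \<otimes>\<^bsub>A\<^esub> \<phi> k (f l)" if "k \<in> carrier K" "l \<in> carrier K" for k l
    using uniq[OF f subgroup.m_closed[OF L f f, of k l, unfolded semidirect_simps]] that by simp
  obtain t where t: "t \<in> carrier A" "\<And>k. k \<in> carrier K \<Longrightarrow> f k = t \<otimes>\<^bsub>A\<^esub> inv\<^bsub>A\<^esub> \<phi> k t"
    using A.crossed_hom_principal[OF assms(2-4) cop, of \<phi> f] actD(1)[OF \<phi>] f Lsub crossed
    by (metis mem_Sigma_iff subsetD)
  have "L = (\<lambda>k. (f k, k)) ` carrier K"
    using f uniq Lsub by (auto simp: image_iff)
  also have "\<dots> = principal_graph A K \<phi> t"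
    unfolding principal_graph_def by (rule image_cong) (simp_all add: t)
  finally show "L \<in> principal_graph A K \<phi> ` carrier A" using t(1) by blast
next
  fix L assume "L \<in> principal_graph A K \<phi> ` carrier A"
  then show "L \<in> complements (semidirect A K \<phi>) (carrier A \<times> {\<one>\<^bsub>K\<^esub>})"
    using principal_graph_complement[OF assms(1,3) \<phi>] by auto
qed

text \<open>If \<open>x\<close> and \<open>y\<close> give the same crossed homomorphism, then
  \<open>x * inv y\<close> is fixed by all of \<open>K\<close>.\<close>

lemma principal_graph_inj:
  assumes "comm_group A" "\<phi> \<in> hom K (AutoGroup A)"
    and triv: "fixed_subgroup A \<phi> (carrier K) \<subseteq> {\<one>\<^bsub>A\<^esub>}"
  shows "inj_on (principal_graph A K \<phi>) (carrier A)"
proof (rule inj_onI)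
  interpret A: comm_group A by fact
  fix x y assume xy: "x \<in> carrier A" "y \<in> carrier A"
    and eq: "principal_graph A K \<phi> x = principal_graph A K \<phi> y"
  have "\<phi> k (x \<otimes>\<^bsub>A\<^esub> inv\<^bsub>A\<^esub> y) = x \<otimes>\<^bsub>A\<^esub> inv\<^bsub>A\<^esub> y" if k: "k \<in> carrier K" for k
  proof -
    interpret h: group_hom A A "\<phi> k" using act_group_hom[OF A.is_group assms(2) k] .
    have "(x \<otimes>\<^bsub>A\<^esub> inv\<^bsub>A\<^esub> \<phi> k x, k) \<in> principal_graph A K \<phi> y"
      unfolding eq[symmetric] using k by (simp add: principal_graph_def)
    then have e: "x \<otimes>\<^bsub>A\<^esub> inv\<^bsub>A\<^esub> \<phi> k x = y \<otimes>\<^bsub>A\<^esub> inv\<^bsub>A\<^esub> \<phi> k y"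
      by (auto simp: principal_graph_def)
    \<comment> \<open>Inserting \<open>\<phi> k x\<close> and its inverse exposes the left side of
      \<open>e\<close>.\<close>
    have "x \<otimes>\<^bsub>A\<^esub> inv\<^bsub>A\<^esub> y = (x \<otimes>\<^bsub>A\<^esub> inv\<^bsub>A\<^esub> \<phi> k x) \<otimes>\<^bsub>A\<^esub> (\<phi> k x \<otimes>\<^bsub>A\<^esub> inv\<^bsub>A\<^esub> y)"
      using xy by (simp add: A.m_assoc A.inv_solve_left)
    also have "\<dots> = (y \<otimes>\<^bsub>A\<^esub> inv\<^bsub>A\<^esub> y) \<otimes>\<^bsub>A\<^esub> (\<phi> k x \<otimes>\<^bsub>A\<^esub> inv\<^bsub>A\<^esub> \<phi> k y)"
      unfolding e using xy by (simp add: A.m_ac A.mult_inv_cancel_left)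
    finally have "x \<otimes>\<^bsub>A\<^esub> inv\<^bsub>A\<^esub> y = \<phi> k x \<otimes>\<^bsub>A\<^esub> inv\<^bsub>A\<^esub> \<phi> k y" using xy by simp
    also have "\<dots> = \<phi> k (x \<otimes>\<^bsub>A\<^esub> inv\<^bsub>A\<^esub> y)" using xy by simp
    finally show ?thesis ..
  qed
  then have "x \<otimes>\<^bsub>A\<^esub> inv\<^bsub>A\<^esub> y \<in> fixed_subgroup A \<phi> (carrier K)"
    using xy by (simp add: fixed_subgroup_def)
  then have "x \<otimes>\<^bsub>A\<^esub> inv\<^bsub>A\<^esub> y = \<one>\<^bsub>A\<^esub>" using triv by blast
  then show "x = y" using xy by (metis A.inv_closed A.inv_equality A.inv_inv)
qed

section \<open>The induced action of \<open>B\<close> on \<open>A/C\<close> and its fixed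
  points\<close>

locale abelian_semidirect = A: comm_group A + K: comm_group K
  for A :: "('a, 'm) monoid_scheme" and K :: "('k, 'n) monoid_scheme" +
  fixes \<phi> :: "'k \<Rightarrow> 'a \<Rightarrow> 'a" and B :: "'k set"
  assumes action: "\<phi> \<in> hom K (AutoGroup A)" and subgroup_B: "subgroup B K"
begin

abbreviation "C \<equiv> fixed_subgroup A \<phi> B"
abbreviation "KB \<equiv> K\<lparr>carrier := B\<rparr>"
abbreviation "\<psi> \<equiv> quotient_action A C \<phi>"

lemma B_carrier: "b \<in> B \<Longrightarrow> b \<in> carrier K"
  using subgroup.mem_carrier[OF subgroup_B] .

sublocale KB: comm_group KB
  using K.m_comm B_carrier
  by (intro group.group_comm_groupI K.subgroup_imp_group[OF subgroup_B]) simp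

lemma act_B_closed: "b \<in> B \<Longrightarrow> a \<in> carrier A \<Longrightarrow> \<phi> b a \<in> carrier A"
  using act_closed[OF action] B_carrier by blast

lemma act_B_mult:
  "b \<in> B \<Longrightarrow> x \<in> carrier A \<Longrightarrow> y \<in> carrier A \<Longrightarrow> \<phi> b (x \<otimes>\<^bsub>A\<^esub> y) = \<phi> b x \<otimes>\<^bsub>A\<^esub> \<phi> b y"
  using act_mult[OF action] B_carrier by blast

lemma act_B_comp:
  "b \<in> B \<Longrightarrow> d \<in> B \<Longrightarrow> x \<in> carrier A \<Longrightarrow> \<phi> (b \<otimes>\<^bsub>K\<^esub> d) x = \<phi> b (\<phi> d x)"
  using act_comp[OF action] B_carrier by blast

lemma act_B_inv: "b \<in> B \<Longrightarrow> x \<in> carrier A \<Longrightarrow> \<phi> b (inv\<^bsub>A\<^esub> x) = inv\<^bsub>A\<^esub> \<phi> b x"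
  using group_hom.hom_inv[OF act_group_hom[OF A.is_group action]] B_carrier by blast

lemma action_KB: "\<phi> \<in> hom KB (AutoGroup A)"
  using action B_carrier by (auto simp: hom_def)

lemma subgroup_C: "subgroup C A"
proof (rule A.subgroupI)
  have "\<phi> b \<one>\<^bsub>A\<^esub> = \<one>\<^bsub>A\<^esub>" if "b \<in> B" for b
    using group_hom.hom_one[OF act_group_hom[OF A.is_group action]] B_carrier that by blast
  then show "C \<noteq> {}" by (auto simp: fixed_subgroup_def)
qed (auto simp: fixed_subgroup_def act_B_inv act_B_mult)

lemma C_carrier: "c \<in> C \<Longrightarrow> c \<in> carrier A"
  using subgroup.mem_carrier[OF subgroup_C] .

lemma C_fixed: "c \<in> C \<Longrightarrow> b \<in> B \<Longrightarrow> \<phi> b c = c"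
  by (simp add: fixed_subgroup_def)

sublocale C: normal C A
  using A.subgroup_imp_normal[OF subgroup_C] .

sublocale AC: comm_group "A Mod C"
  using A.abelian_FactGroup[OF subgroup_C] .

lemma rcos_eq_iff:
  assumes "x \<in> carrier A" "y \<in> carrier A"
  shows "C #>\<^bsub>A\<^esub> x = C #>\<^bsub>A\<^esub> y \<longleftrightarrow> (\<exists>c\<in>C. x = c \<otimes>\<^bsub>A\<^esub> y)"
proof
  assume "C #>\<^bsub>A\<^esub> x = C #>\<^bsub>A\<^esub> y"
  then have "x \<in> C #>\<^bsub>A\<^esub> y"
    using A.repr_independenceD[OF subgroup_C assms(1), of y] by simp
  then show "\<exists>c\<in>C. x = c \<otimes>\<^bsub>A\<^esub> y" by (auto simp: r_coset_def)
next
  assume "\<exists>c\<in>C. x = c \<otimes>\<^bsub>A\<^esub> y"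
  then have "x \<in> C #>\<^bsub>A\<^esub> y" by (auto simp: r_coset_def)
  then show "C #>\<^bsub>A\<^esub> x = C #>\<^bsub>A\<^esub> y"
    using A.repr_independence[OF _ assms(2) subgroup_C] by simp
qed

lemma rcos_eq_C_iff: "x \<in> carrier A \<Longrightarrow> C #>\<^bsub>A\<^esub> x = C \<longleftrightarrow> x \<in> C"
  using A.coset_join1 A.coset_join2 subgroup_C by blast

lemma \<psi>_rcos: "b \<in> B \<Longrightarrow> a \<in> carrier A \<Longrightarrow> \<psi> b (C #>\<^bsub>A\<^esub> a) = C #>\<^bsub>A\<^esub> \<phi> b a"
  using quotient_action_rcos[OF A.is_group action subgroup_B] .

lemma rcos_mult:
  "x \<in> carrier A \<Longrightarrow> y \<in> carrier A \<Longrightarrow>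
    (C #>\<^bsub>A\<^esub> x) \<otimes>\<^bsub>A Mod C\<^esub> (C #>\<^bsub>A\<^esub> y) = C #>\<^bsub>A\<^esub> (x \<otimes>\<^bsub>A\<^esub> y)"
  by (simp add: C.rcos_sum)

lemma rcos_closed: "x \<in> carrier A \<Longrightarrow> C #>\<^bsub>A\<^esub> x \<in> carrier (A Mod C)"
  by (simp add: carrier_FactGroup)

lemma carrier_ModE:
  assumes "S \<in> carrier (A Mod C)" obtains a where "a \<in> carrier A" "S = C #>\<^bsub>A\<^esub> a"
  using assms by (auto simp: carrier_FactGroup)

lemma rcos_inv: "x \<in> carrier A \<Longrightarrow> inv\<^bsub>A Mod C\<^esub> (C #>\<^bsub>A\<^esub> x) = C #>\<^bsub>A\<^esub> (inv\<^bsub>A\<^esub> x)"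
  by (simp add: C.inv_FactGroup rcos_closed C.rcos_inv)

lemma \<psi>_closed:
  assumes "b \<in> B" "S \<in> carrier (A Mod C)" shows "\<psi> b S \<in> carrier (A Mod C)"
  using assms(2) by (rule carrier_ModE) (simp add: assms(1) \<psi>_rcos rcos_closed act_B_closed)

lemma \<psi>_comp:
  assumes "b \<in> B" "d \<in> B" "S \<in> carrier (A Mod C)"
  shows "\<psi> (b \<otimes>\<^bsub>K\<^esub> d) S = \<psi> b (\<psi> d S)"
  using assms(3)
  by (rule carrier_ModE)
    (simp add: assms \<psi>_rcos act_B_closed act_B_comp subgroup.m_closed[OF subgroup_B])

text \<open>Every requirement is checked on coset representatives, where \<open>\<psi>_rcos\<close>
  turns it into the corresponding property of \<open>\<phi>\<close>.\<close>

lemma quotient_action_hom: "\<psi> \<in> hom KB (AutoGroup (A Mod C))"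
proof -
  have id: "\<psi> \<one>\<^bsub>K\<^esub> S = S" if "S \<in> carrier (A Mod C)" for S
    using that
    by (rule carrier_ModE)
      (simp add: \<psi>_rcos subgroup.one_closed[OF subgroup_B] act_one[OF K.is_group action])
  have bij: "\<psi> b \<in> Bij (carrier (A Mod C))" if b: "b \<in> B" for b
  proof -
    have i: "inv\<^bsub>K\<^esub> b \<in> B" using b subgroup.m_inv_closed[OF subgroup_B] by blast
    have "bij_betw (\<psi> b) (carrier (A Mod C)) (carrier (A Mod C))"
    proof (rule bij_betw_byWitness[where f' = "\<psi> (inv\<^bsub>K\<^esub> b)"])
      show "\<forall>S\<in>carrier (A Mod C). \<psi> (inv\<^bsub>K\<^esub> b) (\<psi> b S) = S"
        using b i id B_carrier by (simp flip: \<psi>_comp)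
      show "\<forall>S\<in>carrier (A Mod C). \<psi> b (\<psi> (inv\<^bsub>K\<^esub> b) S) = S"
        using b i id B_carrier by (simp flip: \<psi>_comp)
    qed (use b i \<psi>_closed in auto)
    then show ?thesis by (simp add: Bij_def quotient_action_def)
  qed
  have hom: "\<psi> b \<in> hom (A Mod C) (A Mod C)" if b: "b \<in> B" for b
  proof (rule homI)
    fix S T assume "S \<in> carrier (A Mod C)" "T \<in> carrier (A Mod C)"
    then obtain x y where "x \<in> carrier A" "y \<in> carrier A" "S = C #>\<^bsub>A\<^esub> x" "T = C #>\<^bsub>A\<^esub> y"
      by (metis carrier_ModE)
    then show "\<psi> b (S \<otimes>\<^bsub>A Mod C\<^esub> T) = \<psi> b S \<otimes>\<^bsub>A Mod C\<^esub> \<psi> b T"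
      using b by (simp add: rcos_mult \<psi>_rcos act_B_closed act_B_mult del: mult_FactGroup)
  qed (use b \<psi>_closed in auto)
  show ?thesis
  proof (rule homI)
    fix b assume "b \<in> carrier KB"
    then show "\<psi> b \<in> carrier (AutoGroup (A Mod C))"
      using bij hom by (simp add: AutoGroup_def auto_def)
  next
    fix b d assume bd: "b \<in> carrier KB" "d \<in> carrier KB"
    have "\<psi> (b \<otimes>\<^bsub>K\<^esub> d) = compose (carrier (A Mod C)) (\<psi> b) (\<psi> d)"
    \<comment> \<open>Multiplication in \<open>AutoGroup\<close> is composition restricted to the
      carrier, so the two functions must also agree outside it; the restriction built into
      \<open>quotient_action\<close> ensures this.\<close>
    proof (rule extensionalityI[where A = "carrier (A Mod C)"])
      show "\<psi> (b \<otimes>\<^bsub>K\<^esub> d) \<in> extensional (carrier (A Mod C))"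
        by (simp add: quotient_action_def)
    qed (use bd in \<open>auto simp: \<psi>_comp compose_eq\<close>)
    then show "\<psi> (b \<otimes>\<^bsub>KB\<^esub> d) = \<psi> b \<otimes>\<^bsub>AutoGroup (A Mod C)\<^esub> \<psi> d"
      using bd bij by (simp add: AutoGroup_def BijGroup_def)
  qed
qed

text \<open>If \<open>b\<close> fixes the coset of \<open>a\<close>, then it moves \<open>a\<close>
  by a factor \<open>c\<close> in \<open>C\<close>. As \<open>b\<close> fixes \<open>c\<close>,
  iteration multiplies \<open>a\<close> by powers of \<open>c\<close>; after \<open>|B|\<close>
  steps \<open>b\<close> has become trivial, and coprimality forces \<open>c = 1\<close>. Thus a
  representative of a fixed coset is itself fixed.\<close>

lemma fixed_quotient_trivial:
  assumes fin: "finite (carrier A)" and cop: "coprime (card (carrier A)) (card B)"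
  shows "fixed_subgroup (A Mod C) \<psi> B \<subseteq> {\<one>\<^bsub>A Mod C\<^esub>}"
proof
  fix S assume "S \<in> fixed_subgroup (A Mod C) \<psi> B"
  then have S: "S \<in> carrier (A Mod C)" and fixS: "\<And>b. b \<in> B \<Longrightarrow> \<psi> b S = S"
    unfolding fixed_subgroup_def[of "A Mod C"] by blast+
  obtain a where a: "a \<in> carrier A" "S = C #>\<^bsub>A\<^esub> a" using S by (rule carrier_ModE)
  obtain m :: nat where m: "\<forall>x\<in>carrier A. (x [^]\<^bsub>A\<^esub> card B) [^]\<^bsub>A\<^esub> m = x"
    using A.pow_coprime_card_invertible[OF fin cop] by blast
  have "\<phi> b a = a" if b: "b \<in> B" for b
  proof -
    have "C #>\<^bsub>A\<^esub> \<phi> b a = C #>\<^bsub>A\<^esub> a" using fixS[OF b] a b \<psi>_rcos by simp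
    then obtain c where c: "c \<in> C" "\<phi> b a = c \<otimes>\<^bsub>A\<^esub> a"
      using rcos_eq_iff[OF act_B_closed[OF b a(1)] a(1)] by blast
    have cA: "c \<in> carrier A" using c(1) by (rule C_carrier)
    \<comment> \<open>hence the order of \<open>c\<close> divides both \<open>|A|\<close> and \<open>|B|\<close>\<close>
    have pow: "\<phi> (b [^]\<^bsub>KB\<^esub> j) a = c [^]\<^bsub>A\<^esub> j \<otimes>\<^bsub>A\<^esub> a" for j :: nat
    proof (induction j)
      case 0
      then show ?case using a act_one[OF K.is_group action] by simp
    next
      case (Suc j)
      have bj: "b [^]\<^bsub>KB\<^esub> j \<in> B" using KB.nat_pow_closed[of b j] b by simp
      have "\<phi> (b [^]\<^bsub>KB\<^esub> Suc j) a = \<phi> (b [^]\<^bsub>KB\<^esub> j) (c \<otimes>\<^bsub>A\<^esub> a)"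
        using bj b a act_B_comp c by simp
      also have "\<dots> = c \<otimes>\<^bsub>A\<^esub> (c [^]\<^bsub>A\<^esub> j \<otimes>\<^bsub>A\<^esub> a)"
        using bj a cA C_fixed[OF c(1)] act_B_mult Suc by simp
      also have "\<dots> = c [^]\<^bsub>A\<^esub> Suc j \<otimes>\<^bsub>A\<^esub> a"
        using a cA by (simp add: A.m_ac)
      finally show ?case .
    qed
    have "b [^]\<^bsub>KB\<^esub> card B = \<one>\<^bsub>K\<^esub>"
      using KB.pow_order_eq_1[of b] b by (simp add: order_def)
    then have "c [^]\<^bsub>A\<^esub> card B \<otimes>\<^bsub>A\<^esub> a = a"
      using pow[of "card B"] a act_one[OF K.is_group action] by simp
    then have "c [^]\<^bsub>A\<^esub> card B = \<one>\<^bsub>A\<^esub>"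
      using a cA by simp
    then have "c = \<one>\<^bsub>A\<^esub>" using m cA by force
    then show ?thesis using c a by simp
  qed
  then have "a \<in> C" using a(1) unfolding fixed_subgroup_def by blast
  then show "S \<in> {\<one>\<^bsub>A Mod C\<^esub>}" using a rcos_eq_C_iff by simp
qed

section \<open>The correspondence between \<open>Lambda_set\<close> and the complements in the
  quotient\<close>

lemma semidirect_KB: "semidirect A KB \<phi> = (semidirect A K \<phi>)\<lparr>carrier := carrier A \<times> B\<rparr>"
  by (simp add: semidirect_def)

sublocale G: group "semidirect A K \<phi>"
  using group_semidirect[OF A.is_group K.is_group action] .

sublocale q: group_hom "semidirect A KB \<phi>" "semidirect (A Mod C) KB \<psi>" "quotient_map A C"
proof -
  have "quotient_map A C \<in> hom (semidirect A KB \<phi>) (semidirect (A Mod C) KB \<psi>)"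
    by (auto simp: hom_def quotient_map_def semidirect_simps rcos_closed \<psi>_rcos rcos_mult
        act_B_closed simp del: mult_FactGroup)
  then show "group_hom (semidirect A KB \<phi>) (semidirect (A Mod C) KB \<psi>) (quotient_map A C)"
    using group_semidirect[OF A.is_group KB.is_group action_KB]
      group_semidirect[OF AC.is_group KB.is_group quotient_action_hom]
    by (simp add: group_hom_def group_hom_axioms_def)
qed

lemma subgroup_A_times_B: "subgroup (carrier A \<times> B) (semidirect A K \<phi>)"
  using q.G.is_group B_carrier
  by (intro G.group_incl_imp_subgroup) (auto simp: semidirect_KB semidirect_simps)

abbreviation "quotient_complements \<equiv>
  complements (semidirect (A Mod C) KB \<psi>) (carrier (A Mod C) \<times> {\<one>\<^bsub>KB\<^esub>})"

text \<open>The intersection discards pairs outside the group, since the inverse image of a function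
  is taken over the whole type.\<close>

abbreviation "preimage L \<equiv> quotient_map A C -` L \<inter> carrier (semidirect A KB \<phi>)"

text \<open>The image of \<open>H\<close> projects onto \<open>B\<close> because \<open>H\<close>
  does, and it meets \<open>A/C\<close> trivially because \<open>H\<close> meets \<open>A\<close>
  only in \<open>C\<close>. Moreover \<open>H\<close> contains the kernel
  \<open>C \<times> {1}\<close> of the quotient map, so it is recovered from its image.\<close>

lemma Lambda_set_preimage:
  assumes H: "H \<in> Lambda_set A K \<phi> B"
  shows "quotient_map A C ` H \<in> quotient_complements" "H = preimage (quotient_map A C ` H)"
proof -
  let ?L = "quotient_map A C ` H"
  have sub: "subgroup H (semidirect A K \<phi>)" and snd: "snd ` H = B"
    and int: "H \<inter> (carrier A \<times> {\<one>\<^bsub>K\<^esub>}) = C \<times> {\<one>\<^bsub>K\<^esub>}"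
    using H by (auto simp: Lambda_set_def)
  have HAB: "H \<subseteq> carrier A \<times> B"
    using subgroup.subset[OF sub] snd by (force simp: semidirect_simps)
  have "subgroup H (semidirect A KB \<phi>)"
    unfolding semidirect_KB using G.subgroup_incl[OF sub subgroup_A_times_B HAB] .
  then have L: "subgroup ?L (semidirect (A Mod C) KB \<psi>)"
    by (rule q.subgroup_img_is_subgroup)
  have "snd ` ?L = carrier KB"
    using snd by (force simp: quotient_map_def image_iff)
  moreover have "(carrier (A Mod C) \<times> {\<one>\<^bsub>KB\<^esub>}) \<inter> ?L = {\<one>\<^bsub>semidirect (A Mod C) KB \<psi>\<^esub>}"
  proof -
    have "S = \<one>\<^bsub>A Mod C\<^esub>" if S: "(S, \<one>\<^bsub>K\<^esub>) \<in> ?L" for S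
    proof -
      obtain x where x: "(x, \<one>\<^bsub>K\<^esub>) \<in> H" "S = C #>\<^bsub>A\<^esub> x"
        using S by (auto simp: quotient_map_def)
      then have "x \<in> C" using int HAB by blast
      then show ?thesis using x rcos_eq_C_iff C_carrier by simp
    qed
    moreover have "(\<one>\<^bsub>A Mod C\<^esub>, \<one>\<^bsub>K\<^esub>) \<in> ?L"
      using subgroup.one_closed[OF L] by (simp only: semidirect_simps) simp
    moreover have "\<one>\<^bsub>A Mod C\<^esub> \<in> carrier (A Mod C)"
      by (rule AC.one_closed)
    ultimately have "(carrier (A Mod C) \<times> {\<one>\<^bsub>K\<^esub>}) \<inter> ?L = {(\<one>\<^bsub>A Mod C\<^esub>, \<one>\<^bsub>K\<^esub>)}"
      by blast
    then show ?thesis by (simp add: semidirect_simps)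
  qed
  ultimately show "?L \<in> quotient_complements"
    by (rule complementI_semidirect[OF AC.is_group KB.is_group quotient_action_hom L])
  show "H = preimage ?L"
  proof
    show "H \<subseteq> preimage ?L" using HAB by (auto simp: semidirect_simps)
    show "preimage ?L \<subseteq> H"
    proof
      fix z assume z: "z \<in> preimage ?L"
      obtain x b where zxb: "z = (x, b)" by (cases z)
      with z obtain y d where xb: "(x, b) \<in> carrier (semidirect A KB \<phi>)" and yd: "(y, d) \<in> H"
        and "quotient_map A C (x, b) = quotient_map A C (y, d)" by auto
      then have bd: "b = d" and eq: "C #>\<^bsub>A\<^esub> x = C #>\<^bsub>A\<^esub> y" by (auto simp: quotient_map_def)
      have xy: "x \<in> carrier A" "y \<in> carrier A" "b \<in> B" using xb yd HAB by (auto simp: semidirect_simps)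
      obtain c where c: "c \<in> C" "x = c \<otimes>\<^bsub>A\<^esub> y" using eq rcos_eq_iff xy by blast
      \<comment> \<open>Since the identity of \<open>K\<close> acts trivially, multiplying
        \<open>(y, d)\<close> on the left by this element gives \<open>(x, b)\<close>.\<close>
      then have "(c, \<one>\<^bsub>K\<^esub>) \<in> H" using int by blast
      then have "(c, \<one>\<^bsub>K\<^esub>) \<otimes>\<^bsub>semidirect A K \<phi>\<^esub> (y, d) \<in> H"
        using yd subgroup.m_closed[OF sub] by blast
      then show "z \<in> H"
        using zxb c xy bd act_one[OF K.is_group action] B_carrier by (simp add: semidirect_simps)
    qed
  qed
qed

text \<open>Choosing the representative \<open>a\<close> lifts the crossed homomorphism to
  \<open>A\<close>, and a coset of \<open>C\<close> lies over each of its values. The explicit form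
  makes products computable.\<close>

lemma preimage_principal_graph:
  assumes a: "a \<in> carrier A"
  shows "preimage (principal_graph (A Mod C) KB \<psi> (C #>\<^bsub>A\<^esub> a)) =
    {(c \<otimes>\<^bsub>A\<^esub> (a \<otimes>\<^bsub>A\<^esub> inv\<^bsub>A\<^esub> \<phi> b a), b) | c b. c \<in> C \<and> b \<in> B}" (is "?H = ?R")
proof -
  have mem: "(x, b) \<in> ?H \<longleftrightarrow> (x, b) \<in> ?R" for x b
  proof (cases "x \<in> carrier A \<and> b \<in> B")
    case True
    then have "(x, b) \<in> ?H \<longleftrightarrow> C #>\<^bsub>A\<^esub> x = C #>\<^bsub>A\<^esub> (a \<otimes>\<^bsub>A\<^esub> inv\<^bsub>A\<^esub> \<phi> b a)"
      using a by (auto simp: principal_graph_def quotient_map_def semidirect_simps \<psi>_rcos rcos_inv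
          rcos_mult act_B_closed image_iff simp del: mult_FactGroup)
    then show ?thesis using True a rcos_eq_iff act_B_closed by auto
  next
    case False
    then show ?thesis using a act_B_closed C_carrier by (auto simp: semidirect_simps)
  qed
  show ?thesis
    by (rule equalityI; rule subrelI) (simp_all only: mem)
qed

text \<open>Two elements with \<open>C\<close>-parts \<open>c\<close>, \<open>e\<close> over
  \<open>b\<close>, \<open>d\<close> multiply to the element with \<open>C\<close>-part
  \<open>c * e\<close> over \<open>b * d\<close>. Commutativity of \<open>A\<close> and
  \<open>K\<close> therefore makes the preimage abelian.\<close>

lemma preimage_principal_graph_Lambda:
  assumes a: "a \<in> carrier A"
  shows "preimage (principal_graph (A Mod C) KB \<psi> (C #>\<^bsub>A\<^esub> a)) \<in> Lambda_set A K \<phi> B"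
proof -
  let ?L = "principal_graph (A Mod C) KB \<psi> (C #>\<^bsub>A\<^esub> a)"
  note H = preimage_principal_graph[OF a]
  have L: "subgroup ?L (semidirect (A Mod C) KB \<psi>)"
    using principal_graph_complement[OF AC.comm_group_axioms KB.is_group quotient_action_hom rcos_closed[OF a]]
    by (simp add: complements_def)
  have "subgroup (preimage ?L) (semidirect A KB \<phi>)"
  proof (rule q.G.subgroupI)
    show "preimage ?L \<noteq> {}"
      using subgroup.one_closed[OF L] q.G.one_closed q.hom_one by (metis IntI emptyE vimageI)
  qed (auto intro: subgroup.m_closed[OF L] subgroup.m_inv_closed[OF L])
  then have sub: "subgroup (preimage ?L) (semidirect A K \<phi>)"
    using G.incl_subgroup[OF subgroup_A_times_B] by (simp add: semidirect_KB)
  \<comment> \<open>The element \<open>e\<close> passes through \<open>\<phi> b\<close> unchanged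
    because \<open>C\<close> is fixed by \<open>B\<close>; the remaining factors combine by the
    crossed identity.\<close>
  have comm: "(c \<otimes>\<^bsub>A\<^esub> (a \<otimes>\<^bsub>A\<^esub> inv\<^bsub>A\<^esub> \<phi> b a)) \<otimes>\<^bsub>A\<^esub> \<phi> b (e \<otimes>\<^bsub>A\<^esub> (a \<otimes>\<^bsub>A\<^esub> inv\<^bsub>A\<^esub> \<phi> d a)) =
      c \<otimes>\<^bsub>A\<^esub> (e \<otimes>\<^bsub>A\<^esub> (a \<otimes>\<^bsub>A\<^esub> inv\<^bsub>A\<^esub> \<phi> (b \<otimes>\<^bsub>K\<^esub> d) a))"
    if "c \<in> C" "e \<in> C" "b \<in> B" "d \<in> B" for b c d e
  proof -
    have e: "\<phi> b e = e" using that C_fixed by blast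
    have cl: "c \<in> carrier A" "e \<in> carrier A" "\<phi> b a \<in> carrier A" "\<phi> d a \<in> carrier A"
      "\<phi> b (\<phi> d a) \<in> carrier A"
      using that a by (simp_all add: C_carrier act_B_closed)
    have "\<phi> b (e \<otimes>\<^bsub>A\<^esub> (a \<otimes>\<^bsub>A\<^esub> inv\<^bsub>A\<^esub> \<phi> d a)) = \<phi> b a \<otimes>\<^bsub>A\<^esub> (e \<otimes>\<^bsub>A\<^esub> inv\<^bsub>A\<^esub> \<phi> b (\<phi> d a))"
      using that(3) a cl e by (simp add: act_B_mult act_B_inv A.m_lcomm)
    moreover have "\<phi> (b \<otimes>\<^bsub>K\<^esub> d) a = \<phi> b (\<phi> d a)" by (rule act_B_comp[OF that(3,4) a])
    ultimately show ?thesis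
      using a cl by (simp add: A.m_assoc A.inv_mult_cancel_left A.m_lcomm[of a e])
  qed
  have "comm_group ((semidirect A K \<phi>)\<lparr>carrier := preimage ?L\<rparr>)"
  proof (rule group.group_comm_groupI)
    show "group ((semidirect A K \<phi>)\<lparr>carrier := preimage ?L\<rparr>)"
      using G.subgroup_imp_group[OF sub] .
  next
    fix x y assume "x \<in> carrier ((semidirect A K \<phi>)\<lparr>carrier := preimage ?L\<rparr>)"
      "y \<in> carrier ((semidirect A K \<phi>)\<lparr>carrier := preimage ?L\<rparr>)"
    then obtain c b e d where *: "c \<in> C" "b \<in> B" "e \<in> C" "d \<in> B"
      and xy: "x = (c \<otimes>\<^bsub>A\<^esub> (a \<otimes>\<^bsub>A\<^esub> inv\<^bsub>A\<^esub> \<phi> b a), b)" "y = (e \<otimes>\<^bsub>A\<^esub> (a \<otimes>\<^bsub>A\<^esub> inv\<^bsub>A\<^esub> \<phi> d a), d)"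
      unfolding H by auto
    have bd: "b \<otimes>\<^bsub>K\<^esub> d = d \<otimes>\<^bsub>K\<^esub> b" "b \<otimes>\<^bsub>K\<^esub> d \<in> B"
      using * B_carrier K.m_comm subgroup.m_closed[OF subgroup_B] by auto
    \<comment> \<open>Both orders of multiplication share this factor, so only \<open>c\<close> and
      \<open>e\<close> remain to be exchanged.\<close>
    define w where "w = a \<otimes>\<^bsub>A\<^esub> inv\<^bsub>A\<^esub> \<phi> (d \<otimes>\<^bsub>K\<^esub> b) a"
    have "w \<in> carrier A" using a bd by (simp add: w_def act_B_closed)
    then have "c \<otimes>\<^bsub>A\<^esub> (e \<otimes>\<^bsub>A\<^esub> w) = e \<otimes>\<^bsub>A\<^esub> (c \<otimes>\<^bsub>A\<^esub> w)"
      using * by (simp add: A.m_lcomm C_carrier)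
    then show "x \<otimes>\<^bsub>(semidirect A K \<phi>)\<lparr>carrier := preimage ?L\<rparr>\<^esub> y =
      y \<otimes>\<^bsub>(semidirect A K \<phi>)\<lparr>carrier := preimage ?L\<rparr>\<^esub> x"
      using * bd(1) by (simp add: xy semidirect_simps comm w_def)
  qed
  moreover have "snd ` preimage ?L = B"
  proof
    show "snd ` preimage ?L \<subseteq> B" by (auto simp: semidirect_simps)
    show "B \<subseteq> snd ` preimage ?L"
    proof
      fix b assume "b \<in> B"
      then have "(\<one>\<^bsub>A\<^esub> \<otimes>\<^bsub>A\<^esub> (a \<otimes>\<^bsub>A\<^esub> inv\<^bsub>A\<^esub> \<phi> b a), b) \<in> preimage ?L"
        unfolding H using subgroup.one_closed[OF subgroup_C] by blast
      then show "b \<in> snd ` preimage ?L" by (rule image_eqI[rotated]) simp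
    qed
  qed
  moreover have "preimage ?L \<inter> (carrier A \<times> {\<one>\<^bsub>K\<^esub>}) = C \<times> {\<one>\<^bsub>K\<^esub>}"
  proof -
    \<comment> \<open>Over the identity the crossed homomorphism is trivial, so the fibre there is
      exactly \<open>C\<close>.\<close>
    have one: "c \<otimes>\<^bsub>A\<^esub> (a \<otimes>\<^bsub>A\<^esub> inv\<^bsub>A\<^esub> \<phi> \<one>\<^bsub>K\<^esub> a) = c" if "c \<in> C" for c
      using a C_carrier[OF that] act_one[OF K.is_group action a] by simp
    have mem: "(x, \<one>\<^bsub>K\<^esub>) \<in> preimage ?L \<longleftrightarrow>
        (\<exists>c\<in>C. x = c \<otimes>\<^bsub>A\<^esub> (a \<otimes>\<^bsub>A\<^esub> inv\<^bsub>A\<^esub> \<phi> \<one>\<^bsub>K\<^esub> a))" for x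
      unfolding H using subgroup.one_closed[OF subgroup_B] by blast
    have "(x, \<one>\<^bsub>K\<^esub>) \<in> preimage ?L \<longleftrightarrow> x \<in> C" for x
      unfolding mem by (simp add: one)
    then show ?thesis using C_carrier by blast
  qed
  ultimately show ?thesis using sub by (simp add: Lambda_set_def)
qed

end

section \<open>Counting the complements and their preimages\<close>

theorem theorem4p5:
  fixes A :: "('a, 'm) monoid_scheme"
    and K :: "('k, 'n) monoid_scheme"
    and \<phi> :: "'k \<Rightarrow> 'a \<Rightarrow> 'a"
    and B :: "'k set"
  assumes "comm_group A" and "finite (carrier A)"
    and "comm_group K" and "finite (carrier K)"
    and "\<phi> \<in> hom K (AutoGroup A)"
    and "subgroup B K"
    and "gcd (card (carrier A)) (card B) = 1"
  defines "C \<equiv> fixed_subgroup A \<phi> B"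
  defines "KB \<equiv> K\<lparr>carrier := B\<rparr>"
  defines "compl \<equiv> complements (semidirect (A Mod C) KB (quotient_action A C \<phi>))
                     (carrier (A Mod C) \<times> {\<one>\<^bsub>KB\<^esub>})"
  shows "card (Lambda_set A K \<phi> B) = card (rcosets\<^bsub>A\<^esub> C) \<and>
    Lambda_set A K \<phi> B =
      (\<lambda>L. quotient_map A C -` L \<inter> carrier (semidirect A KB \<phi>)) ` compl \<and>
    card compl = card (rcosets\<^bsub>A\<^esub> C)"
proof -
  interpret S: abelian_semidirect A K \<phi> B
    using assms(1,3,5,6) by (simp add: abelian_semidirect_def abelian_semidirect_axioms_def)
  have cop: "coprime (card (carrier A)) (card B)" using assms(7) by (simp add: coprime_iff_gcd_eq_1)
  have finB: "finite B" using assms(4) S.B_carrier by (meson finite_subset subsetI)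
  have Mod: "carrier (A Mod C) = rcosets\<^bsub>A\<^esub> C" by (simp add: FactGroup_def)
  have finM: "finite (carrier (A Mod C))"
    using assms(2) by (simp add: carrier_FactGroup)
  \<comment> \<open>By Lagrange the order of \<open>A/C\<close> divides that of \<open>A\<close>, so
    it inherits coprimality to \<open>|B|\<close>.\<close>
  have "card (carrier A) = card (carrier (A Mod C)) * card C"
    unfolding Mod using S.A.lagrange[OF S.subgroup_C] by (simp add: C_def order_def)
  then have copM: "coprime (card (carrier (A Mod C))) (card (carrier KB))"
    using cop by (simp add: KB_def)
  have compl: "compl = principal_graph (A Mod C) KB (quotient_action A C \<phi>) ` carrier (A Mod C)"
    unfolding compl_def
  proof (rule complements_semidirect_coprime[OF _ finM _ _ _ copM])
    show "comm_group (A Mod C)" "group KB" "quotient_action A C \<phi> \<in> hom KB (AutoGroup (A Mod C))"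
      unfolding C_def KB_def
      by (fact S.AC.comm_group_axioms S.KB.is_group S.quotient_action_hom)+
    show "finite (carrier KB)" using finB by (simp add: KB_def)
  qed
  \<comment> \<open>Distinct elements of \<open>A/C\<close> give distinct complements because
    \<open>B\<close> has no nontrivial fixed point there; hence the number of complements is the
    index of \<open>C\<close>.\<close>
  have "inj_on (principal_graph (A Mod C) KB (quotient_action A C \<phi>)) (carrier (A Mod C))"
    unfolding C_def KB_def
    by (rule principal_graph_inj[OF S.AC.comm_group_axioms S.quotient_action_hom])
      (use S.fixed_quotient_trivial[OF assms(2) cop] in simp)
  then have card_compl: "card compl = card (rcosets\<^bsub>A\<^esub> C)"
    unfolding compl by (simp add: card_image Mod)
  let ?pre = "\<lambda>L. quotient_map A C -` L \<inter> carrier (semidirect A KB \<phi>)"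
  have Lambda: "Lambda_set A K \<phi> B = ?pre ` compl"
  proof
    show "Lambda_set A K \<phi> B \<subseteq> ?pre ` compl"
      using S.Lambda_set_preimage unfolding C_def KB_def compl_def by blast
    show "?pre ` compl \<subseteq> Lambda_set A K \<phi> B"
      using S.preimage_principal_graph_Lambda unfolding compl C_def KB_def
      by (auto elim!: S.carrier_ModE)
  qed
  have "inj_on ?pre compl"
  \<comment> \<open>The quotient map is onto, so taking the image of a preimage returns the original
    complement.\<close>
  proof (rule inj_on_inverseI[where g = "(`) (quotient_map A C)"])
    fix L assume "L \<in> compl"
    then have "subgroup L (semidirect (A Mod C) KB (quotient_action A C \<phi>))"
      by (simp add: compl_def complements_def)
    then have "L \<subseteq> carrier (A Mod C) \<times> carrier KB"
      using subgroup.subset by (fastforce simp: semidirect_simps)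
    also have "\<dots> \<subseteq> quotient_map A C ` carrier (semidirect A KB \<phi>)"
      by (force simp: quotient_map_def semidirect_simps carrier_FactGroup)
    finally show "quotient_map A C ` ?pre L = L" by blast
  qed
  then have "card (Lambda_set A K \<phi> B) = card (rcosets\<^bsub>A\<^esub> C)"
    unfolding Lambda using card_compl by (simp add: card_image)
  then show ?thesis using Lambda card_compl by blast
qed

end
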